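(* Consider the functional optimization problem $$J_2:\quad\min_{\boldsymbol{c}(\cdot)}\ \int_0^\tau\big\|\boldsymbol{\Gamma}(\theta)\,\boldsymbol{c}(\theta)-\hat{\boldsymbol{m}}\big\|^2d\theta+\mu\int_0^\tau\boldsymbol{c}(\theta)^\top\boldsymbol{c}(\theta)\,d\theta\quad\text{s.t.}\quad\int_0^\tau\boldsymbol{c}(\theta)\,d\theta=\boldsymbol{\psi},$$ where $0<\mu\ll 1$, and $\boldsymbol{\Gamma}(\theta)$, $\hat{\boldsymbol{m}}$ and $\boldsymbol{\psi}$ are the matrix function and vectors defined in the context. The globally optimal solution of $J_2$ is obtained by $$\boldsymbol{c}(\theta)=\boldsymbol{\Pi}^{-1}(\theta)\left(\boldsymbol{\Gamma}(\theta)^\top\hat{\boldsymbol{m}}-\boldsymbol{\lambda}\right),$$ where $$\boldsymbol{\Pi}(\theta)=\boldsymbol{\Gamma}(\theta)^\top\boldsymbol{\Gamma}(\theta)+\mu\boldsymbol{I},$$ $$\boldsymbol{\lambda}=\left(\int_0^\tau\boldsymbol{\Pi}^{-1}(\theta)\,d\theta\right)^{-1}\left(\int_0^\tau\boldsymbol{\Pi}^{-1}(\theta)\boldsymbol{\Gamma}(\theta)^\top d\theta\;\hat{\boldsymbol{m}}-\boldsymbol{\psi}\right).$$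
   Context: Underlying problem. $N,M$ are positive integers, $\tau>0$, $\boldsymbol{u}\in\mathbb{R}^N$, $f:\mathbb{R}^N\to\mathbb{R}$, and $\boldsymbol{h}_m=[h_{m,1},\ldots,h_{m,N}]^\top:\mathbb{R}^N\to\mathbb{R}^N$ for $m\in\{1,\ldots,M\}$. One considers the time-varying problem $P_1(\theta)$ of minimizing $\sum_{m=1}^M b_m(\theta)f(\boldsymbol{x}_m(\theta))$ over $\boldsymbol{x}_1(\theta),\ldots,\boldsymbol{x}_M(\theta)\in\mathbb{R}^N$ subject to $\sum_{m=1}^M\boldsymbol{h}_m(\boldsymbol{x}_m(\theta))=\boldsymbol{u}$, where the scalar functions $b_m$ satisfy $b_m(\theta)\to p_{0,m}$ as $\theta\to0$ and $b_m(\theta)\to p_{\tau,m}$ as $\theta\to\tau$ for given non-zero numbers $p_{0,m},p_{\tau,m}$. The solution of $P_1(0)$ is given. Write $\boldsymbol{x}(\theta)=[\boldsymbol{x}_1^\top,\ldots,\boldsymbol{x}_M^\top]^\top(\theta)$. Standing assumptions: $f$ and all $\boldsymbol{h}_m$ are twice continuously differentiable, and $\boldsymbol{\mathcal{J}}_m\in\mathbb{R}^{N\times N}$, the transpose of the Jacobian matrix of $\boldsymbol{h}_m$ with respect to $\boldsymbol{x}_m(\theta)$, is invertible for every $m$ and every $\theta\in[0,\tau]$. Parametric functions. $\boldsymbol{c}(\theta)=[c_1,\ldots,c_M]^\top(\theta)$ with $c_m(\theta)=\dot b_m(\theta)/b_m(\theta)$, and $\boldsymbol{\psi}=[\psi_1,\ldots,\psi_M]^\top$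 with $\psi_m=\log(p_{\tau,m}/p_{0,m})$. The matrix $\boldsymbol{\Gamma}$. The dynamical system tracking the solution of $P_1(\theta)$ is $\dot{\boldsymbol{x}}(\theta)=\boldsymbol{\phi}(\boldsymbol{x}(\theta),\theta)=\boldsymbol{\Gamma}(\theta)\boldsymbol{c}(\theta)$, where $\boldsymbol{\Gamma}(\theta)\in\mathbb{R}^{NM\times M}$ is the block matrix whose block in block-row $n$ and column $m$ ($n,m\in\{1,\ldots,M\}$) is $$\boldsymbol{\gamma}_{nm}=-G_n^{-1}\bigg(\Big(\sum_{k=1}^M D_k\Big)^{-1}D_m-\delta_{nm}\boldsymbol{I}\bigg)\boldsymbol{1}\in\mathbb{R}^N,$$ $$G_n=\mathrm{diag}(\boldsymbol{v})^{-1}\boldsymbol{\mathcal{J}}_n^{-1}\Big(\nabla_n^2 f+\sum_{j=1}^N v_j\nabla_n^2 h_{n,j}\Big),\qquad D_m=\boldsymbol{\mathcal{J}}_m^\top G_m^{-1},\qquad \boldsymbol{v}=-\boldsymbol{\mathcal{J}}_m^{-1}\nabla_m f.$$ Here $\nabla_m,\nabla_m^2$ are the gradient and Hessian with respect to $\boldsymbol{x}_m$, $\delta_{nm}$ is the Kronecker delta, $\boldsymbol{1}$ is the all-ones vector, and $\boldsymbol{I}$ is the identity matrix ($N\times N$ here, $M\times M$ in $\boldsymbol{\Pi}$). Thus $\boldsymbol{\Gamma}$ depends on $\boldsymbol{x}(\theta)$ and has no explicit dependence on $\boldsymbol{c}(\cdot)$. Role of $J_2$ and definition of $\hat{\boldsymbol{m}}$.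 $J_2$ is the second step of an iteration that alternates two steps, starting from some $\boldsymbol{c}(\cdot)$ with $\int_0^\tau\boldsymbol{c}(\theta)d\theta=\boldsymbol{\psi}$. In the first (prediction) step, with the most recently updated $\boldsymbol{c}(\cdot)$, the trajectory is predicted from the known $\boldsymbol{x}(0)$ by the Euler scheme $\hat{\boldsymbol{x}}(\theta)=\hat{\boldsymbol{x}}(\theta-\Delta\theta)+\Delta\theta\,\hat{\dot{\boldsymbol{x}}}(\theta-\Delta\theta)$, $\theta\in(0,\tau]$, where $\hat{\dot{\boldsymbol{x}}}(\theta)=\boldsymbol{\phi}(\hat{\boldsymbol{x}}(\theta),\theta)$, $\Delta\theta$ is the incremental step and $\tau=L\Delta\theta$. In the second step, $J_2$ is solved for the updated $\boldsymbol{c}(\cdot)$, based on the predicted trajectory: $\boldsymbol{\Gamma}(\theta)$ is taken along that trajectory, and $$\hat{\boldsymbol{m}}=\frac1L\sum_{j=1}^L\hat{\dot{\boldsymbol{x}}}(\tau-j\Delta\theta)\in\mathbb{R}^{NM},$$ which does not depend on $\theta$. The term with $\mu$ regulates the smoothness of $\boldsymbol{c}$, $\mu$ being the regulation coefficient; $\|\cdot\|$ is the Euclidean norm. *)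

theory Defs
  imports "HOL-Analysis.Analysis"
begin

definition gradient :: "(real ^ 'n \<Rightarrow> real) \<Rightarrow> real ^ 'n \<Rightarrow> real ^ 'n" where
  "gradient g x = (\<chi> i. frechet_derivative g (at x) (axis i 1))"

definition hessian :: "(real ^ 'n \<Rightarrow> real) \<Rightarrow> real ^ 'n \<Rightarrow> real ^ 'n ^ 'n" where
  "hessian g x = jacobian (gradient g) (at x)"

definition twice_continuously_differentiable :: "(real ^ 'n \<Rightarrow> real) \<Rightarrow> bool" where
  "twice_continuously_differentiable g \<longleftrightarrow>
     (\<forall>x. g differentiable (at x)) \<and>
     (\<forall>x. gradient g differentiable (at x)) \<and>
     continuous_on UNIV (hessian g)"

definition diag_mat :: "real ^ 'n \<Rightarrow> real ^ 'n ^ 'n" where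
  "diag_mat v = (\<chi> i j. if i = j then v $ i else 0)"

(* A stacked vector of M blocks of length N has index type 'm * 'n; CARD('m) = M, CARD('n) = N. *)
definition block :: "real ^ ('m::finite \<times> 'n) \<Rightarrow> 'm \<Rightarrow> real ^ 'n" where
  "block x m = (\<chi> i. x $ (m, i))"

definition P1_solution ::
  "real ^ 'm::finite \<Rightarrow> (real ^ 'n \<Rightarrow> real) \<Rightarrow> ('m \<Rightarrow> real ^ 'n \<Rightarrow> real ^ 'n) \<Rightarrow> real ^ 'n
     \<Rightarrow> real ^ ('m \<times> 'n) \<Rightarrow> bool" where
  "P1_solution b f h u x \<longleftrightarrow>
     (\<Sum>m\<in>UNIV. h m (block x m)) = u \<and>
     (\<forall>y. (\<Sum>m\<in>UNIV. h m (block y m)) = u \<longrightarrow>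
        (\<Sum>m\<in>UNIV. b $ m * f (block x m)) \<le> (\<Sum>m\<in>UNIV. b $ m * f (block y m)))"

definition J_mat ::
  "('m::finite \<Rightarrow> real ^ 'n \<Rightarrow> real ^ 'n) \<Rightarrow> real ^ ('m \<times> 'n) \<Rightarrow> 'm \<Rightarrow> real ^ 'n ^ 'n" where
  "J_mat h x m = transpose (jacobian (h m) (at (block x m)))"

(* With KKT multiplier lam one has lam = b_m v_m for every block m, so v carries the block index,
   and G_n below is built from v_n. *)
definition v_vec ::
  "(real ^ 'n \<Rightarrow> real) \<Rightarrow> ('m::finite \<Rightarrow> real ^ 'n \<Rightarrow> real ^ 'n) \<Rightarrow> real ^ ('m \<times> 'n) \<Rightarrow> 'm \<Rightarrow> real ^ 'n" where
  "v_vec f h x m = - (matrix_inv (J_mat h x m) *v gradient f (block x m))"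

definition G_mat ::
  "(real ^ 'n \<Rightarrow> real) \<Rightarrow> ('m::finite \<Rightarrow> real ^ 'n \<Rightarrow> real ^ 'n) \<Rightarrow> real ^ ('m \<times> 'n) \<Rightarrow> 'm \<Rightarrow> real ^ 'n ^ 'n" where
  "G_mat f h x n =
     matrix_inv (diag_mat (v_vec f h x n)) ** matrix_inv (J_mat h x n) **
     (hessian f (block x n) +
      (\<Sum>j\<in>UNIV. v_vec f h x n $ j *\<^sub>R hessian (\<lambda>y. h n y $ j) (block x n)))"

definition D_mat ::
  "(real ^ 'n \<Rightarrow> real) \<Rightarrow> ('m::finite \<Rightarrow> real ^ 'n \<Rightarrow> real ^ 'n) \<Rightarrow> real ^ ('m \<times> 'n) \<Rightarrow> 'm \<Rightarrow> real ^ 'n ^ 'n" where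
  "D_mat f h x m = transpose (J_mat h x m) ** matrix_inv (G_mat f h x m)"

definition gamma_block ::
  "(real ^ 'n \<Rightarrow> real) \<Rightarrow> ('m::finite \<Rightarrow> real ^ 'n \<Rightarrow> real ^ 'n) \<Rightarrow> real ^ ('m \<times> 'n)
     \<Rightarrow> 'm \<Rightarrow> 'm \<Rightarrow> real ^ 'n" where
  "gamma_block f h x n m =
     - (matrix_inv (G_mat f h x n) *v
        ((matrix_inv (\<Sum>k\<in>UNIV. D_mat f h x k) ** D_mat f h x m - (if n = m then mat 1 else 0))
          *v (\<chi> i. 1)))"

definition Gamma_mat ::
  "(real ^ 'n \<Rightarrow> real) \<Rightarrow> ('m::finite \<Rightarrow> real ^ 'n \<Rightarrow> real ^ 'n) \<Rightarrow> real ^ ('m \<times> 'n)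
     \<Rightarrow> real ^ 'm ^ ('m \<times> 'n)" where
  "Gamma_mat f h x = (\<chi> p m. gamma_block f h x (fst p) m $ snd p)"

definition phi ::
  "(real ^ 'n \<Rightarrow> real) \<Rightarrow> ('m::finite \<Rightarrow> real ^ 'n \<Rightarrow> real ^ 'n) \<Rightarrow> (real \<Rightarrow> real ^ 'm)
     \<Rightarrow> real ^ ('m \<times> 'n) \<Rightarrow> real \<Rightarrow> real ^ ('m \<times> 'n)" where
  "phi f h c x \<theta> = Gamma_mat f h x *v c \<theta>"

text \<open>
  A predicted trajectory on the interval from 0 to \<open>L * \<Delta>\<close>. The Euler scheme determines the values
  at the grid points; between them the trajectory is only required to be measurable, so every
  interpolation (piecewise constant, piecewise linear, ...) is covered.
\<close>

definition predicted_trajectory ::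
  "(real ^ 'n \<Rightarrow> real) \<Rightarrow> ('m::finite \<Rightarrow> real ^ 'n \<Rightarrow> real ^ 'n) \<Rightarrow> (real \<Rightarrow> real ^ 'm)
     \<Rightarrow> real ^ ('m \<times> 'n) \<Rightarrow> nat \<Rightarrow> real \<Rightarrow> (real \<Rightarrow> real ^ ('m \<times> 'n)) \<Rightarrow> bool" where
  "predicted_trajectory f h c x0 L \<Delta> xhat \<longleftrightarrow>
     xhat 0 = x0 \<and>
     (\<forall>j\<in>{1..L}. let \<theta> = real j * \<Delta> in
        xhat \<theta> = xhat (\<theta> - \<Delta>) + \<Delta> *\<^sub>R phi f h c (xhat (\<theta> - \<Delta>)) (\<theta> - \<Delta>)) \<and>
     xhat \<in> borel_measurable (lebesgue_on {0..real L * \<Delta>})"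

definition mean_velocity ::
  "(real ^ 'n \<Rightarrow> real) \<Rightarrow> ('m::finite \<Rightarrow> real ^ 'n \<Rightarrow> real ^ 'n) \<Rightarrow> (real \<Rightarrow> real ^ 'm)
     \<Rightarrow> real \<Rightarrow> nat \<Rightarrow> real \<Rightarrow> (real \<Rightarrow> real ^ ('m \<times> 'n)) \<Rightarrow> real ^ ('m \<times> 'n)" where
  "mean_velocity f h c \<tau> L \<Delta> xhat =
     (1 / real L) *\<^sub>R (\<Sum>j=1..L. phi f h c (xhat (\<tau> - real j * \<Delta>)) (\<tau> - real j * \<Delta>))"

definition J2_feasible :: "real \<Rightarrow> real ^ 'm \<Rightarrow> (real \<Rightarrow> real ^ 'm) \<Rightarrow> bool" where
  "J2_feasible \<tau> \<psi> c \<longleftrightarrow>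
     integrable (lebesgue_on {0..\<tau>}) c \<and> (LINT \<theta>|lebesgue_on {0..\<tau>}. c \<theta>) = \<psi>"

(* Extended-valued, so that a feasible c that is not square integrable has infinite cost
   instead of the default value 0 of the Bochner integral. *)
definition J2_cost ::
  "real \<Rightarrow> real \<Rightarrow> (real \<Rightarrow> real ^ 'm ^ 'k) \<Rightarrow> real ^ 'k \<Rightarrow> (real \<Rightarrow> real ^ 'm) \<Rightarrow> ennreal" where
  "J2_cost \<tau> \<mu> \<Gamma> mh c =
     (\<integral>\<^sup>+ \<theta>. ennreal ((norm (\<Gamma> \<theta> *v c \<theta> - mh))\<^sup>2) \<partial>lebesgue_on {0..\<tau>}) +
     ennreal \<mu> * (\<integral>\<^sup>+ \<theta>. ennreal (c \<theta> \<bullet> c \<theta>) \<partial>lebesgue_on {0..\<tau>})"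

definition J2_solution ::
  "real \<Rightarrow> real \<Rightarrow> (real \<Rightarrow> real ^ 'm ^ 'k) \<Rightarrow> real ^ 'k \<Rightarrow> real ^ 'm \<Rightarrow> (real \<Rightarrow> real ^ 'm) \<Rightarrow> bool" where
  "J2_solution \<tau> \<mu> \<Gamma> mh \<psi> c \<longleftrightarrow>
     J2_feasible \<tau> \<psi> c \<and>
     (\<forall>c'. J2_feasible \<tau> \<psi> c' \<longrightarrow> J2_cost \<tau> \<mu> \<Gamma> mh c \<le> J2_cost \<tau> \<mu> \<Gamma> mh c')"

end

theory Submission
  imports Defs
begin

text \<open>
  Completing the square: let \<open>P = \<Gamma>\<^sup>T \<Gamma> + \<mu> I\<close>, let \<open>F(c)\<close> be the integrand of the cost of \<open>c\<close>, and let
  \<open>c = P\<^sup>-\<^sup>1 (\<Gamma>\<^sup>T m - \<lambda>)\<close>. For every \<open>d\<close> one has \<open>F(c + d) = F(c) + d\<^sup>T P d - 2 d\<^sup>T \<lambda>\<close> pointwise. If \<open>c + d\<close> is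
  feasible, then \<open>d\<close> has integral 0, so the linear term integrates to 0 and the cost grows by
  the integral of \<open>d\<^sup>T P d \<ge> \<mu> |d|\<^sup>2\<close>, which gives optimality and uniqueness.
  The operator norms of \<open>P\<^sup>-\<^sup>1\<close>, \<open>P\<^sup>-\<^sup>1 \<Gamma>\<^sup>T\<close> and the cost density of \<open>c\<close> are bounded by constants depending only on \<open>\<mu>\<close>, \<open>m\<close>
  and \<open>\<lambda>\<close>, so all integrals exist although \<open>\<Gamma>\<close> need not be bounded.
\<close>

section \<open>Measurability of matrix operations\<close>

lemma borel_measurable_vec_nth [measurable (raw)]:
  fixes F :: "'a \<Rightarrow> 'b::euclidean_space ^ 'n"
  assumes "F \<in> borel_measurable M"
  shows "(\<lambda>x. F x $ i) \<in> borel_measurable M"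
  by (rule borel_measurable_continuous_on[OF _ assms]) (intro continuous_intros)

lemma borel_measurable_vecI:
  fixes F :: "'a \<Rightarrow> 'b::euclidean_space ^ 'n"
  assumes "\<And>i. (\<lambda>x. F x $ i) \<in> borel_measurable M"
  shows "F \<in> borel_measurable M"
  using assms
  by (subst borel_measurable_euclidean_space) (auto simp: Basis_vec_def inner_axis)

lemma borel_measurable_vec_lambda [measurable (raw)]:
  fixes F :: "'n::finite \<Rightarrow> 'a \<Rightarrow> 'b::euclidean_space"
  assumes "\<And>i. F i \<in> borel_measurable M"
  shows "(\<lambda>x. \<chi> i. F i x) \<in> borel_measurable M"
  by (rule borel_measurable_vecI) (use assms in simp)

lemma borel_measurable_matrix_vector_mult [measurable (raw)]:
  fixes A :: "'a \<Rightarrow> real ^ 'n ^ 'm"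
  assumes [measurable]: "A \<in> borel_measurable M" "v \<in> borel_measurable M"
  shows "(\<lambda>x. A x *v v x) \<in> borel_measurable M"
  unfolding matrix_vector_mult_def by measurable

lemma borel_measurable_matrix_matrix_mult [measurable (raw)]:
  fixes A :: "'a \<Rightarrow> real ^ 'n ^ 'm" and B :: "'a \<Rightarrow> real ^ 'k ^ 'n"
  assumes [measurable]: "A \<in> borel_measurable M" "B \<in> borel_measurable M"
  shows "(\<lambda>x. A x ** B x) \<in> borel_measurable M"
  unfolding matrix_matrix_mult_def by measurable

lemma borel_measurable_transpose [measurable (raw)]:
  fixes A :: "'a \<Rightarrow> real ^ 'n ^ 'm"
  assumes [measurable]: "A \<in> borel_measurable M"
  shows "(\<lambda>x. transpose (A x)) \<in> borel_measurable M"
  unfolding transpose_def by measurable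

lemma borel_measurable_det [measurable (raw)]:
  fixes A :: "'a \<Rightarrow> real ^ 'n ^ 'n"
  assumes [measurable]: "A \<in> borel_measurable M"
  shows "(\<lambda>x. det (A x)) \<in> borel_measurable M"
  unfolding det_def by measurable

lemma matrix_inv_right_left:
  fixes A :: "real ^ 'n ^ 'n"
  assumes "invertible A"
  shows "A ** matrix_inv A = mat 1" "matrix_inv A ** A = mat 1"
  using someI_ex[OF assms[unfolded invertible_def]] unfolding matrix_inv_def by auto

text \<open>Column \<open>l\<close> of the inverse solves a linear system with right-hand side
  \<open>axis l 1\<close>, so Cramer's rule applies. The resulting quotient of determinants is
  visibly measurable in the entries of \<open>A\<close>.\<close>

lemma matrix_inv_nth:
  fixes A :: "real ^ 'n ^ 'n"
  assumes "det A \<noteq> 0"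
  shows "matrix_inv A $ k $ l =
    det (\<chi> i j. if j = k then axis l 1 $ i else A $ i $ j) / det A"
proof -
  have "A *v (matrix_inv A *v axis l 1) = axis l 1"
    using assms by (simp add: matrix_vector_mul_assoc matrix_inv_right_left invertible_det_nz)
  then have "matrix_inv A *v axis l 1 =
      (\<chi> k. det (\<chi> i j. if j = k then axis l 1 $ i else A $ i $ j) / det A)"
    using cramer[OF assms] by blast
  then show ?thesis
    by (simp add: vec_eq_iff matrix_vector_mul_component inner_axis)
qed

text \<open>On singular matrices \<^const>\<open>matrix_inv\<close> chooses from an empty predicate, hence always returns the
  same junk matrix. This keeps it measurable on the whole space.\<close>

lemma matrix_inv_singular:
  fixes A :: "real ^ 'n ^ 'n"
  assumes "\<not> invertible A"
  shows "matrix_inv A = (SOME B. False)"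
  using assms unfolding invertible_def matrix_inv_def by (metis (full_types))

lemma borel_measurable_matrix_inv [measurable (raw)]:
  fixes A :: "'a \<Rightarrow> real ^ 'n ^ 'n"
  assumes [measurable]: "A \<in> borel_measurable M"
  shows "(\<lambda>x. matrix_inv (A x)) \<in> borel_measurable M"
proof (intro borel_measurable_vecI)
  fix k l :: 'n
  \<comment> \<open>The junk value in the singular branch does not depend on \<open>x\<close>, so
    both branches are measurable.\<close>
  have eq: "(\<lambda>x. matrix_inv (A x) $ k $ l) = (\<lambda>x. if det (A x) = 0
      then (SOME B::real ^ 'n ^ 'n. False) $ k $ l
      else det (\<chi> i j. if j = k then axis l 1 $ i else A x $ i $ j) / det (A x))"
    by (auto simp: fun_eq_iff matrix_inv_nth matrix_inv_singular invertible_det_nz)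
  show "(\<lambda>x. matrix_inv (A x) $ k $ l) \<in> borel_measurable M"
    unfolding eq by measurable
qed

section \<open>Measurability of the matrix Gamma\<close>

lemma borel_measurable_gradient:
  assumes "twice_continuously_differentiable g"
  shows "gradient g \<in> borel_measurable borel"
  using assms unfolding twice_continuously_differentiable_def
  by (intro borel_measurable_continuous_onI continuous_at_imp_continuous_on ballI
      differentiable_imp_continuous_within) auto

lemma borel_measurable_hessian:
  assumes "twice_continuously_differentiable g"
  shows "hessian g \<in> borel_measurable borel"
  using assms unfolding twice_continuously_differentiable_def
  by (intro borel_measurable_continuous_onI) auto

text \<open>Taking a component is bounded linear and so commutes with the derivative. Smoothness of
  \<open>h\<close> is assumed componentwise; this reduces its Jacobian to gradients of the
  components.\<close>

lemma jacobian_nth: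
  fixes g :: "real ^ 'n \<Rightarrow> real ^ 'm"
  assumes "\<And>i. (\<lambda>y. g y $ i) differentiable (at x)"
  shows "jacobian g (at x) $ i $ j = gradient (\<lambda>y. g y $ i) x $ j"
proof -
  have "g differentiable (at x)"
    using assms by (subst differentiable_componentwise_within) (auto simp: Basis_vec_def inner_axis)
  then have "(g has_derivative frechet_derivative g (at x)) (at x)"
    by (simp add: frechet_derivative_works)
  then have "((\<lambda>y. g y $ i) has_derivative (\<lambda>v. frechet_derivative g (at x) v $ i)) (at x)"
    by (rule bounded_linear.has_derivative[OF bounded_linear_vec_nth])
  then have "frechet_derivative (\<lambda>y. g y $ i) (at x) = (\<lambda>v. frechet_derivative g (at x) v $ i)"
    by (rule frechet_derivative_at[symmetric])
  then show ?thesis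
    by (simp add: jacobian_def matrix_def gradient_def)
qed

text \<open>Gradients and Hessians are continuous, and the rest is matrix algebra. Since
  \<open>matrix_inv\<close> is Borel on all matrices, points where some inverse fails to exist need
  no separate treatment.\<close>

lemma borel_measurable_Gamma_mat:
  fixes f :: "real ^ 'n \<Rightarrow> real" and h :: "'m::finite \<Rightarrow> real ^ 'n \<Rightarrow> real ^ 'n"
  assumes f: "twice_continuously_differentiable f"
    and h: "\<And>m j. twice_continuously_differentiable (\<lambda>y. h m y $ j)"
  shows "Gamma_mat f h \<in> borel_measurable borel"
proof -
  note [measurable] = borel_measurable_gradient[OF f]
    borel_measurable_hessian[OF f]
    borel_measurable_gradient[OF h]
    borel_measurable_hessian[OF h]
  have [measurable]: "(\<lambda>x :: real ^ ('m \<times> 'n). block x m) \<in> borel_measurable borel" for m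
    unfolding block_def by measurable
  have J: "J_mat h x m = (\<chi> i j. gradient (\<lambda>y. h m y $ j) (block x m) $ i)" for x m
    using h unfolding J_mat_def transpose_def twice_continuously_differentiable_def
    by (simp add: jacobian_nth vec_eq_iff)
  have [measurable]: "(\<lambda>x. J_mat h x m) \<in> borel_measurable borel" for m
    unfolding J by measurable
  have [measurable]: "(\<lambda>x. v_vec f h x m) \<in> borel_measurable borel" for m
    unfolding v_vec_def by measurable
  have [measurable]: "(\<lambda>x. diag_mat (v_vec f h x m)) \<in> borel_measurable borel" for m
    unfolding diag_mat_def by measurable
  have [measurable]: "(\<lambda>x. G_mat f h x m) \<in> borel_measurable borel" for m
    unfolding G_mat_def by measurable
  have [measurable]: "(\<lambda>x. D_mat f h x m) \<in> borel_measurable borel" for m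
    unfolding D_mat_def by measurable
  have [measurable]: "(\<lambda>x. gamma_block f h x n m) \<in> borel_measurable borel" for n m
    unfolding gamma_block_def by measurable
  show ?thesis
    unfolding Gamma_mat_def[abs_def] by measurable
qed

section \<open>Regularized Gram matrices\<close>

text \<open>The normal matrix of Tikhonov-regularized least squares.\<close>

definition regularized_gram :: "real \<Rightarrow> real ^ 'm ^ 'k \<Rightarrow> real ^ 'm ^ 'm" where
  "regularized_gram \<mu> A = transpose A ** A + \<mu> *\<^sub>R mat 1"

lemma inner_transpose_mult:
  fixes A :: "real ^ 'm ^ 'k"
  shows "x \<bullet> (transpose A *v y) = (A *v x) \<bullet> y"
  by (metis dot_lmul_matrix inner_commute transpose_matrix_vector)

text \<open>The associated bilinear form; invertibility, the norm bounds and positivity below are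
  all read off from it.\<close>

lemma inner_regularized_gram:
  "x \<bullet> (regularized_gram \<mu> A *v y) = (A *v x) \<bullet> (A *v y) + \<mu> * (x \<bullet> y)"
proof -
  have "regularized_gram \<mu> A *v y = transpose A *v (A *v y) + \<mu> *\<^sub>R y"
    by (simp add: regularized_gram_def matrix_vector_mult_add_rdistrib
        scaleR_matrix_vector_assoc[symmetric] matrix_vector_mul_assoc)
  then show ?thesis
    by (simp add: inner_add_right inner_transpose_mult del: transpose_matrix_vector)
qed

lemma invertible_regularized_gram:
  assumes "\<mu> > 0"
  shows "invertible (regularized_gram \<mu> A)"
proof -
  have "x = 0" if "regularized_gram \<mu> A *v x = 0" for x
  proof -
    have "(A *v x) \<bullet> (A *v x) + \<mu> * (x \<bullet> x) = 0"
      using inner_regularized_gram[of x \<mu> A x] that by simp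
    moreover have "(A *v x) \<bullet> (A *v x) \<ge> 0" by simp
    ultimately have "\<mu> * (x \<bullet> x) \<le> 0" by linarith
    with assms show "x = 0"
      by (metis inner_gt_zero_iff mult_pos_pos not_less)
  qed
  then show ?thesis
    by (simp add: invertible_left_inverse matrix_left_invertible_ker)
qed

text \<open>With \<open>x\<close> the preimage of \<open>y\<close>, pairing with \<open>x\<close>
  and Cauchy-Schwarz give mu |x|^2 \<le> x . y \<le> |x| |y|. The bound is uniform in
  \<open>A\<close>.\<close>

lemma norm_inv_regularized_gram_le:
  assumes "\<mu> > 0"
  shows "norm (matrix_inv (regularized_gram \<mu> A) *v y) \<le> 1 / \<mu> * norm y"
proof -
  define x where "x = matrix_inv (regularized_gram \<mu> A) *v y"
  have "regularized_gram \<mu> A *v x = y"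
    by (simp add: x_def matrix_vector_mul_assoc matrix_inv_right_left
        invertible_regularized_gram assms)
  then have "(A *v x) \<bullet> (A *v x) + \<mu> * (x \<bullet> x) = x \<bullet> y"
    by (metis inner_regularized_gram)
  moreover have "(A *v x) \<bullet> (A *v x) \<ge> 0" by simp
  moreover have "x \<bullet> y \<le> norm x * norm y" by (rule norm_cauchy_schwarz)
  ultimately have "\<mu> * (x \<bullet> x) \<le> norm x * norm y"
    by linarith
  then have "norm x * (\<mu> * norm x) \<le> norm x * norm y"
    by (simp add: power2_norm_eq_inner[symmetric] power2_eq_square algebra_simps)
  then have "\<mu> * norm x \<le> norm y"
    by (cases "x = 0") auto
  then show ?thesis
    using assms by (simp add: x_def field_simps)
qed

lemma norm_inv_regularized_gram_transpose_le:
  assumes "\<mu> > 0"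
  shows "norm ((matrix_inv (regularized_gram \<mu> A) ** transpose A) *v y) \<le> 1 / (2 * sqrt \<mu>) * norm y"
proof -
  define x where "x = (matrix_inv (regularized_gram \<mu> A) ** transpose A) *v y"
  have "regularized_gram \<mu> A *v x = transpose A *v y"
    by (simp add: x_def matrix_vector_mul_assoc matrix_mul_assoc matrix_inv_right_left
        invertible_regularized_gram assms)
  then have "(A *v x) \<bullet> (A *v x) + \<mu> * (x \<bullet> x) = (A *v x) \<bullet> y"
    by (metis inner_regularized_gram inner_transpose_mult)
  \<comment> \<open>The square says Ax . y - |Ax|^2 \<le> |y|^2 / 4, and the left side equals mu
    |x|^2. This removes \<open>A\<close> from the bound.\<close>
  moreover have "0 \<le> (A *v x - (1/2) *\<^sub>R y) \<bullet> (A *v x - (1/2) *\<^sub>R y)" by simp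
  ultimately have "\<mu> * (x \<bullet> x) \<le> (1/4) * (y \<bullet> y)"
    by (simp add: inner_diff inner_commute algebra_simps)
  then have "(2 * sqrt \<mu> * norm x)\<^sup>2 \<le> (norm y)\<^sup>2"
    using assms by (simp add: power_mult_distrib power2_norm_eq_inner)
  then have "2 * sqrt \<mu> * norm x \<le> norm y"
    by (rule power2_le_imp_le) simp
  then show ?thesis
    using assms by (simp add: x_def field_simps)
qed

text \<open>Substituting y = Px turns the form of the inverse into |Ax|^2 + mu |x|^2.\<close>

lemma inner_inv_regularized_gram_pos:
  assumes "\<mu> > 0" "y \<noteq> 0"
  shows "y \<bullet> (matrix_inv (regularized_gram \<mu> A) *v y) > 0"
proof -
  define x where "x = matrix_inv (regularized_gram \<mu> A) *v y"
  have y: "regularized_gram \<mu> A *v x = y"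
    by (simp add: x_def matrix_vector_mul_assoc matrix_inv_right_left
        invertible_regularized_gram assms)
  then have "x \<noteq> 0" using \<open>y \<noteq> 0\<close> by auto
  then have "(A *v x) \<bullet> (A *v x) + \<mu> * (x \<bullet> x) > 0"
    using assms by (intro add_nonneg_pos) auto
  then show ?thesis
    unfolding x_def[symmetric] by (metis inner_regularized_gram y inner_commute)
qed

section \<open>Integrals of matrix functions\<close>

text \<open>The norm on matrices is the Euclidean one, not the operator norm. Entries are components
  of images of unit vectors, hence at most \<open>B\<close>; the crude constant suffices for
  integrability.\<close>

lemma norm_matrix_le:
  fixes A :: "real ^ 'n ^ 'm"
  assumes "\<And>y. norm (A *v y) \<le> B * norm y"
  shows "norm A \<le> real CARD('m) * (real CARD('n) * B)"
proof -
  have entry: "\<bar>A $ i $ j\<bar> \<le> B" for i j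
  proof -
    have "\<bar>A $ i $ j\<bar> = \<bar>(A *v axis j 1) $ i\<bar>"
      by (simp add: matrix_vector_mul_component inner_axis)
    also have "\<dots> \<le> norm (A *v axis j 1)" by (rule component_le_norm_cart)
    also have "\<dots> \<le> B" using assms[of "axis j 1"] by simp
    finally show ?thesis .
  qed
  have "norm (A $ i) \<le> real CARD('n) * B" for i
    using norm_le_l1_cart[of "A $ i"] sum_bounded_above[of UNIV "\<lambda>j. \<bar>A $ i $ j\<bar>" B] entry
    by force
  then have "(\<Sum>i\<in>UNIV. norm (A $ i)) \<le> real CARD('m) * (real CARD('n) * B)"
    using sum_bounded_above[of UNIV "\<lambda>i. norm (A $ i)"] by force
  moreover have "norm A \<le> (\<Sum>i\<in>UNIV. norm (A $ i))"
    unfolding norm_vec_def by (rule L2_set_le_sum) simp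
  ultimately show ?thesis by linarith
qed

lemma bounded_linear_matrix_vector_mult_left:
  "bounded_linear (\<lambda>A :: real ^ 'n ^ 'm. A *v y)"
  unfolding linear_conv_bounded_linear[symmetric]
  by (rule linearI) (simp_all add: matrix_vector_mult_add_rdistrib scaleR_matrix_vector_assoc)

lemma
  fixes A :: "'a \<Rightarrow> real ^ 'n ^ 'm"
  assumes "integrable M A"
  shows integrable_matrix_vector_mult_left: "integrable M (\<lambda>x. A x *v y)"
    and integral_matrix_vector_mult_left: "(LINT x|M. A x *v y) = (LINT x|M. A x) *v y"
  using integrable_bounded_linear[OF bounded_linear_matrix_vector_mult_left assms]
    integral_bounded_linear[OF bounded_linear_matrix_vector_mult_left assms] by auto

lemma (in finite_measure) integrable_matrix_const_bound:
  fixes A :: "'a \<Rightarrow> real ^ 'n ^ 'm"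
  assumes "A \<in> borel_measurable M" "\<And>x y. norm (A x *v y) \<le> B * norm y"
  shows "integrable M A"
  using assms(1) by (intro integrable_const_bound AE_I2) (rule norm_matrix_le[OF assms(2)])

section \<open>Regularized least squares with prescribed mean\<close>

text \<open>The problem over an arbitrary finite measure. \<open>nonzero_space\<close> excludes the
  null measure, for which the integral of \<open>Pinv\<close> would be the zero matrix.\<close>

locale regularized_least_squares = finite_measure M
  for M :: "'a measure" +
  fixes A :: "'a \<Rightarrow> real ^ 'm ^ 'k" and \<mu> :: real and b :: "real ^ 'k" and \<psi> :: "real ^ 'm"
  assumes measurable_A [measurable]: "A \<in> borel_measurable M"
    and \<mu>_pos: "\<mu> > 0"
    and nonzero_space: "emeasure M (space M) \<noteq> 0"
begin

abbreviation Pinv :: "'a \<Rightarrow> real ^ 'm ^ 'm" where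
  "Pinv x \<equiv> matrix_inv (regularized_gram \<mu> (A x))"

text \<open>Half the Lagrange multiplier of the mean constraint, found by requiring
  \<open>solution\<close> to integrate to \<psi>.\<close>

definition multiplier :: "real ^ 'm" where
  "multiplier = matrix_inv (LINT x|M. Pinv x) *v
     ((LINT x|M. Pinv x ** transpose (A x)) *v b - \<psi>)"

definition solution :: "'a \<Rightarrow> real ^ 'm" where
  "solution x = Pinv x *v (transpose (A x) *v b - multiplier)"

definition feasible :: "('a \<Rightarrow> real ^ 'm) \<Rightarrow> bool" where
  "feasible c \<longleftrightarrow> integrable M c \<and> (LINT x|M. c x) = \<psi>"

definition density :: "('a \<Rightarrow> real ^ 'm) \<Rightarrow> 'a \<Rightarrow> real" where
  "density c x = (norm (A x *v c x - b))\<^sup>2 + \<mu> * (c x \<bullet> c x)"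

definition cost :: "('a \<Rightarrow> real ^ 'm) \<Rightarrow> ennreal" where
  "cost c = (\<integral>\<^sup>+ x. ennreal ((norm (A x *v c x - b))\<^sup>2) \<partial>M) +
     ennreal \<mu> * (\<integral>\<^sup>+ x. ennreal (c x \<bullet> c x) \<partial>M)"

lemma measurable_Pinv [measurable]: "Pinv \<in> borel_measurable M"
  unfolding regularized_gram_def by measurable

lemma integrable_Pinv: "integrable M Pinv"
  by (rule integrable_matrix_const_bound[OF measurable_Pinv norm_inv_regularized_gram_le[OF \<mu>_pos]])

lemma integrable_Pinv_transpose: "integrable M (\<lambda>x. Pinv x ** transpose (A x))"
  by (rule integrable_matrix_const_bound[OF _ norm_inv_regularized_gram_transpose_le[OF \<mu>_pos]])
    measurable

text \<open>The quadratic form of the integral is the integral of positive forms. A kernel vector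
  would make a strictly positive function vanish almost everywhere, against
  \<open>nonzero_space\<close>.\<close>

lemma invertible_integral_Pinv: "invertible (LINT x|M. Pinv x)"
proof -
  have "y = 0" if "(LINT x|M. Pinv x) *v y = 0" for y
  proof (rule ccontr)
    assume "y \<noteq> 0"
    note pos = inner_inv_regularized_gram_pos[OF \<mu>_pos \<open>y \<noteq> 0\<close>]
    have int: "integrable M (\<lambda>x. y \<bullet> (Pinv x *v y))"
      by (intro integrable_inner_right integrable_matrix_vector_mult_left integrable_Pinv)
    have "(LINT x|M. y \<bullet> (Pinv x *v y)) = y \<bullet> ((LINT x|M. Pinv x) *v y)"
      by (simp add: integral_inner_right integrable_matrix_vector_mult_left integrable_Pinv
          integral_matrix_vector_mult_left)
    then have "(LINT x|M. y \<bullet> (Pinv x *v y)) = 0"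
      using that by simp
    then have "AE x in M. y \<bullet> (Pinv x *v y) = 0"
      by (subst (asm) integral_nonneg_eq_0_iff_AE[OF int]) (auto intro!: less_imp_le pos)
    then have "AE x in M. False"
      by (rule AE_mp) (use pos in \<open>auto intro!: AE_I2 simp: less_le\<close>)
    then show False
      using nonzero_space by (simp add: eventually_False ae_filter_eq_bot_iff)
  qed
  then show ?thesis
    by (simp add: invertible_left_inverse matrix_left_invertible_ker)
qed

text \<open>The grouping matters for integration: \<open>transpose (A x)\<close> alone may fail to
  be integrable, whereas its product with \<open>Pinv x\<close> is bounded.\<close>

lemma solution_eq:
  "solution x = (Pinv x ** transpose (A x)) *v b - Pinv x *v multiplier"
  by (simp add: solution_def matrix_vector_mult_diff_distrib matrix_vector_mul_assoc
      del: transpose_matrix_vector)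

lemma feasible_solution: "feasible solution"
proof -
  note ints = integrable_matrix_vector_mult_left[OF integrable_Pinv]
    integrable_matrix_vector_mult_left[OF integrable_Pinv_transpose]
  have "(LINT x|M. solution x) =
      (LINT x|M. Pinv x ** transpose (A x)) *v b - (LINT x|M. Pinv x) *v multiplier"
    unfolding solution_eq
    by (simp add: ints integral_matrix_vector_mult_left integrable_Pinv integrable_Pinv_transpose)
  also have "\<dots> = \<psi>"
    by (simp add: multiplier_def matrix_vector_mul_assoc matrix_inv_right_left
        invertible_integral_Pinv)
  finally show ?thesis
    unfolding feasible_def solution_eq[abs_def] using ints by (auto simp: solution_eq[abs_def])
qed

text \<open>The pointwise Euler-Lagrange equation of the constrained problem.\<close>

lemma stationarity:
  "transpose (A x) *v b = regularized_gram \<mu> (A x) *v solution x + multiplier"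
  by (simp add: solution_def matrix_vector_mul_assoc matrix_inv_right_left
      invertible_regularized_gram \<mu>_pos)

lemma density_nonneg: "0 \<le> density c x"
  using \<mu>_pos by (simp add: density_def)

lemma density_completed_square:
  fixes c
  defines "d \<equiv> \<lambda>x. c x - solution x"
  shows "density c x = density solution x
    + ((A x *v d x) \<bullet> (A x *v d x) + \<mu> * (d x \<bullet> d x)) - 2 * (d x \<bullet> multiplier)"
proof -
  have "(A x *v d x) \<bullet> b =
      (A x *v d x) \<bullet> (A x *v solution x) + \<mu> * (d x \<bullet> solution x) + d x \<bullet> multiplier"
    unfolding inner_transpose_mult[symmetric, of _ _ b] stationarity[of x]
    by (simp add: inner_add_right inner_regularized_gram del: transpose_matrix_vector)
  moreover have "c x = solution x + d x"
    by (simp add: d_def)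
  ultimately show ?thesis
    unfolding density_def
    by (simp add: power2_norm_eq_inner matrix_vector_right_distrib inner_add inner_diff
        inner_commute algebra_simps)
qed

text \<open>Pairing stationarity with \<open>solution x\<close> itself eliminates the term linear in
  \<open>b\<close>, leaving a concave function of the solution. The bound is free of
  \<open>x\<close>, so the density is integrable on a finite measure.\<close>

lemma density_solution_le:
  "density solution x \<le> (multiplier \<bullet> multiplier) / \<mu> + b \<bullet> b"
proof -
  define c where "c = solution x"
  have "(A x *v c) \<bullet> b = (A x *v c) \<bullet> (A x *v c) + \<mu> * (c \<bullet> c) + c \<bullet> multiplier"
    unfolding inner_transpose_mult[symmetric, of _ _ b] stationarity[of x] c_def
    by (simp add: inner_add_right inner_regularized_gram del: transpose_matrix_vector)
  then have "density solution x =
      b \<bullet> b - (A x *v c) \<bullet> (A x *v c) - \<mu> * (c \<bullet> c) - 2 * (c \<bullet> multiplier)"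
    by (simp add: density_def c_def[symmetric] power2_norm_eq_inner inner_diff inner_commute)
  moreover have "(A x *v c) \<bullet> (A x *v c) \<ge> 0" by simp
  \<comment> \<open>Completes the square in -mu |c|^2 - 2 c . \<open>multiplier\<close>, whose
    maximum is |\<open>multiplier\<close>|^2 / mu.\<close>
  moreover have "0 \<le> (\<mu> *\<^sub>R c + multiplier) \<bullet> (\<mu> *\<^sub>R c + multiplier) / \<mu>"
    using \<mu>_pos by simp
  then have "0 \<le> \<mu> * (c \<bullet> c) + 2 * (c \<bullet> multiplier) + (multiplier \<bullet> multiplier) / \<mu>"
    using \<mu>_pos by (simp add: inner_add inner_commute field_simps)
  ultimately show ?thesis by linarith
qed

lemma measurable_density [measurable]:
  assumes [measurable]: "c \<in> borel_measurable M"
  shows "density c \<in> borel_measurable M"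
  unfolding density_def by measurable

lemma cost_eq_nn_integral:
  assumes [measurable]: "c \<in> borel_measurable M"
  shows "cost c = (\<integral>\<^sup>+ x. ennreal (density c x) \<partial>M)"
  using \<mu>_pos unfolding cost_def density_def
  by (simp add: nn_integral_add nn_integral_cmult ennreal_mult)

lemma cost_eq_integral:
  assumes "integrable M (density c)" "c \<in> borel_measurable M"
  shows "cost c = ennreal (LINT x|M. density c x)"
  using assms by (simp add: cost_eq_nn_integral nn_integral_eq_integral density_nonneg)

lemma integrable_density_solution: "integrable M (density solution)"
  using feasible_solution density_solution_le density_nonneg[of solution]
  by (intro integrable_const_bound AE_I2) (auto simp: feasible_def)

lemma cost_solution_finite: "cost solution < \<infinity>"
  using feasible_solution
  by (auto simp: cost_eq_integral integrable_density_solution feasible_def)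

text \<open>Finite cost makes the density of \<open>c\<close> integrable, so the extended-valued
  costs become real integrals that can be subtracted.\<close>

lemma
  assumes feas: "feasible c" and finite: "cost c < \<infinity>"
  shows cost_solution_le_of_finite: "cost solution \<le> cost c"
    and AE_eq_solution: "cost c \<le> cost solution \<Longrightarrow> AE x in M. c x = solution x"
proof -
  define d where "d = (\<lambda>x. c x - solution x)"
  define Q where "Q = (\<lambda>x. (A x *v d x) \<bullet> (A x *v d x) + \<mu> * (d x \<bullet> d x))"
  have [measurable]: "c \<in> borel_measurable M" and meas_sol: "solution \<in> borel_measurable M"
    using feas feasible_solution by (auto simp: feasible_def)
  have int_c: "integrable M (density c)"
    using finite
    by (intro integrableI_nonneg) (auto simp: cost_eq_nn_integral density_nonneg)
  have int_d: "integrable M d" and d0: "(LINT x|M. d x) = 0"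
    using feas feasible_solution by (auto simp: d_def feasible_def)
  \<comment> \<open>Integrability of \<open>Q\<close> is obtained from this form, since its
    definition involves the possibly unbounded \<open>A\<close>.\<close>
  have Q_eq: "Q = (\<lambda>x. density c x - density solution x + 2 * (d x \<bullet> multiplier))"
    using density_completed_square[of c] by (auto simp: Q_def d_def)
  have int_Q: "integrable M Q"
    unfolding Q_eq
    using int_c integrable_density_solution int_d by auto
  have "(LINT x|M. d x \<bullet> multiplier) = 0"
    using int_d d0 by simp
  then have Q_int: "(LINT x|M. Q x) = (LINT x|M. density c x) - (LINT x|M. density solution x)"
    unfolding Q_eq using int_c integrable_density_solution int_d by simp
  have Q_nonneg: "Q x \<ge> 0" for x
    using \<mu>_pos by (simp add: Q_def)
  then have "(LINT x|M. Q x) \<ge> 0" by simp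
  then have le: "(LINT x|M. density solution x) \<le> (LINT x|M. density c x)"
    using Q_int by simp
  then show "cost solution \<le> cost c"
    using int_c integrable_density_solution meas_sol by (simp add: cost_eq_integral ennreal_leI)
  show "AE x in M. c x = solution x" if "cost c \<le> cost solution"
  proof -
    have "(LINT x|M. density c x) \<le> (LINT x|M. density solution x)"
      using that int_c integrable_density_solution meas_sol
      by (simp add: cost_eq_integral ennreal_le_iff density_nonneg integral_nonneg)
    then have "(LINT x|M. Q x) = 0"
      using Q_int le by simp
    then have "AE x in M. Q x = 0"
      using integral_nonneg_eq_0_iff_AE[OF int_Q] Q_nonneg by simp
    then show ?thesis
    proof (rule AE_mp, intro AE_I2 impI)
      fix x assume "Q x = 0"
      then have "\<mu> * (d x \<bullet> d x) \<le> 0"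
        unfolding Q_def using inner_ge_zero[of "A x *v d x"] by linarith
      then show "c x = solution x"
        using \<mu>_pos unfolding d_def
        by (metis inner_gt_zero_iff mult_pos_pos not_less right_minus_eq)
    qed
  qed
qed

lemma cost_solution_le:
  assumes "feasible c"
  shows "cost solution \<le> cost c"
  using cost_solution_le_of_finite[OF assms] by (cases "cost c < \<infinity>") (auto simp: not_less top_unique)

text \<open>A competitor no worse than \<open>solution\<close> automatically has finite cost, so the
  finite case applies.\<close>

lemma minimizer_AE_unique:
  assumes "feasible c" "cost c \<le> cost solution"
  shows "AE x in M. c x = solution x"
  using AE_eq_solution assms cost_solution_finite le_less_trans by blast

end

section \<open>Specialization to Lebesgue measure on the time interval\<close>

theorem proposition3:
  fixes f :: "real ^ 'n \<Rightarrow> real"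
    and h :: "'m::finite \<Rightarrow> real ^ 'n \<Rightarrow> real ^ 'n"
    and u :: "real ^ 'n"
    and p0 p\<tau> \<psi> lam :: "real ^ 'm"
    and \<tau> \<mu> \<Delta> :: real
    and L :: nat
    and x0 mh :: "real ^ ('m \<times> 'n)"
    and cprev c :: "real \<Rightarrow> real ^ 'm"
    and xhat :: "real \<Rightarrow> real ^ ('m \<times> 'n)"
    and \<Gamma> :: "real \<Rightarrow> real ^ 'm ^ ('m \<times> 'n)"
    and Pmat :: "real \<Rightarrow> real ^ 'm ^ 'm"
  assumes "\<tau> > 0" and "\<mu> > 0" and "L \<ge> 1" and "\<tau> = real L * \<Delta>"
    and "twice_continuously_differentiable f"
    and "\<And>m j. twice_continuously_differentiable (\<lambda>y. h m y $ j)"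
    and "\<And>m. p0 $ m \<noteq> 0" and "\<And>m. p\<tau> $ m \<noteq> 0"
    and "\<psi> = (\<chi> m. ln (p\<tau> $ m / p0 $ m))"
    and "P1_solution p0 f h u x0"
    and "J2_feasible \<tau> \<psi> cprev"
    and "predicted_trajectory f h cprev x0 L \<Delta> xhat"
    and "\<And>m \<theta>. \<theta> \<in> {0..\<tau>} \<Longrightarrow> invertible (J_mat h (xhat \<theta>) m)"
    and "\<Gamma> = (\<lambda>\<theta>. Gamma_mat f h (xhat \<theta>))"
    and "mh = mean_velocity f h cprev \<tau> L \<Delta> xhat"
    and "Pmat = (\<lambda>\<theta>. transpose (\<Gamma> \<theta>) ** \<Gamma> \<theta> + \<mu> *\<^sub>R mat 1)"
    and "lam = matrix_inv (LINT \<theta>|lebesgue_on {0..\<tau>}. matrix_inv (Pmat \<theta>)) *v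
           ((LINT \<theta>|lebesgue_on {0..\<tau>}. matrix_inv (Pmat \<theta>) ** transpose (\<Gamma> \<theta>)) *v mh - \<psi>)"
    and "c = (\<lambda>\<theta>. matrix_inv (Pmat \<theta>) *v (transpose (\<Gamma> \<theta>) *v mh - lam))"
  shows
    \<comment> \<open>the inverses and integrals in the formulas exist\<close>
    "(\<forall>\<theta>\<in>{0..\<tau>}. invertible (Pmat \<theta>)) \<and>
     integrable (lebesgue_on {0..\<tau>}) (\<lambda>\<theta>. matrix_inv (Pmat \<theta>)) \<and>
     integrable (lebesgue_on {0..\<tau>}) (\<lambda>\<theta>. matrix_inv (Pmat \<theta>) ** transpose (\<Gamma> \<theta>)) \<and>
     invertible (LINT \<theta>|lebesgue_on {0..\<tau>}. matrix_inv (Pmat \<theta>)) \<and>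
     J2_cost \<tau> \<mu> \<Gamma> mh c < \<infinity> \<and>
     J2_solution \<tau> \<mu> \<Gamma> mh \<psi> c \<and>
     (\<forall>c'. J2_solution \<tau> \<mu> \<Gamma> mh \<psi> c' \<longrightarrow> (AE \<theta> in lebesgue_on {0..\<tau>}. c' \<theta> = c \<theta>))"
proof -
  define M where "M = lebesgue_on {0..\<tau>}"
  note asm = assms
  have "xhat \<in> borel_measurable M"
    using asm(12) unfolding predicted_trajectory_def M_def asm(4) by blast
  \<comment> \<open>\<open>Gamma_mat f h\<close> is Borel and the trajectory is Lebesgue measurable;
    in this order the composition is measurable.\<close>
  then have meas: "\<Gamma> \<in> borel_measurable M"
    unfolding asm(14)
    by (rule measurable_compose[OF _ borel_measurable_Gamma_mat]) (use asm(5,6) in auto)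
  interpret finite_measure M
    unfolding M_def by (rule finite_measure_lebesgue_on) simp
  have "emeasure M (space M) \<noteq> 0"
    using asm(1) by (simp add: M_def emeasure_restrict_space)
  then interpret regularized_least_squares M \<Gamma> \<mu> mh \<psi>
    using meas asm(2) by unfold_locales
  have P: "Pmat = (\<lambda>\<theta>. regularized_gram \<mu> (\<Gamma> \<theta>))"
    unfolding asm(16) regularized_gram_def ..
  have lam: "lam = multiplier"
    unfolding asm(17) P M_def[symmetric] multiplier_def ..
  have c: "c = solution"
    unfolding asm(18) solution_def[abs_def] P lam ..
  have feas: "J2_feasible \<tau> \<psi> = feasible"
    unfolding J2_feasible_def[abs_def] M_def[symmetric] feasible_def[abs_def] ..
  have J2: "J2_cost \<tau> \<mu> \<Gamma> mh = cost"
    unfolding J2_cost_def[abs_def] M_def[symmetric] cost_def[abs_def] ..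
  have sol: "J2_solution \<tau> \<mu> \<Gamma> mh \<psi> c' \<longleftrightarrow>
      feasible c' \<and> (\<forall>c''. feasible c'' \<longrightarrow> cost c' \<le> cost c'')" for c'
    unfolding J2_solution_def feas J2 ..
  show ?thesis
    unfolding sol J2 unfolding c P M_def[symmetric]
    using invertible_regularized_gram[OF asm(2)] integrable_Pinv integrable_Pinv_transpose
      invertible_integral_Pinv cost_solution_finite feasible_solution cost_solution_le
      minimizer_AE_unique
    by blast
qed

end
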